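(* Let $G(n,n_1,n_2,p_1,p_2)$ be a two-layer stochastic block model network. Let $\{l,k\}=\{1,2\}$, and let $Q_l$ and $Q'_l$ be the modularity of layer $l$ before and after applying ReduceEdge to all communities of the other layer $k$. Then $Q'_l>Q_l$. That is, the modularity of a layer increases if ReduceEdge is applied on all communities of the other layer.
   Context: Two-layer stochastic block model $G(n,n_1,n_2,p_1,p_2)$: $n,n_1,n_2$ are positive integers with $n_1,n_2\ge 3$, and $p_1,p_2\in(0,1]$. For $l=1,2$, layer $l$ is a partition of the $n$ nodes into $n_l$ communities, each of size $s_l=n/n_l$. The two layers are independent of each other, so that each community of layer 1 and each community of layer 2 have $r=n/(n_1n_2)$ nodes in common; $s_1,s_2,r$ are treated as integers and the intersection sizes as exactly $r$. A node pair is internal to layer $l$ if both nodes lie in the same community of layer $l$. Independently for each pair, a pair internal only to layer 1 forms an edge with probability $p_1$, a pair internal only to layer 2 with probability $p_2$, a pair internal to both layers with probability $p_{12}=p_1+p_2-p_1p_2$, and a pair internal to neither layer never forms an edge. Self-loops are allowed and pairs are counted so that a set of $s$ nodes contains $\tfrac12 s^2$ node pairs. All edge counts are expected numbers. For layer $l$, $e_{ll}$ is the expected number of edges internal to one community of layer $l$, $e_{lout}$ is the expected number of edges with exactly one endpoint in that community (these numbers are the same for all communities of the layer), and $d_l=2e_{ll}+e_{lout}$. The total number of edges is $e=\tfrac12 n_l d_l$. The modularity of layer $l$ is $Q_l=\sum_{i}\left[\frac{e_{ll}}{e}-\left(\frac{d_l}{2e}\right)^2\right]$, the sum being over the $n_l$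 communities $i$ of layer $l$. After an operation on the network, modularity is given by the same formula with the (expected) edge counts of the modified network. ReduceEdge on layer $k$: let $\widehat p$ be the (expected) observed edge probability on node pairs internal to communities of layer $k$, that is $\widehat p=e_{kk}/(\tfrac12 s_k^2)$, and let $\widehat q$ be the (expected) observed edge probability on node pairs across communities of layer $k$ (the background noise), that is $\widehat q=e_{kout}/(s_k(n-s_k))$. Each edge internal to layer $k$ is kept independently with probability $q'_k=\frac{1-\widehat p}{1-\widehat q}$ and removed otherwise (so the expected numbers of edges internal to layer $k$ are multiplied by $q'_k$); all other edges are left unchanged. *)

theory Defs
  imports "HOL-Probability.Probability" "HOL-Probability.Product_PMF"
begin

(* A node pair is the set {u, v} of its endpoints (a singleton in case of a self-loop),
   a network is its set of edges, and a random network is a pmf of such edge sets. *)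

definition node_pairs :: "'a set \<Rightarrow> 'a set set" where
  "node_pairs S = {{u, v} | u v. u \<in> S \<and> v \<in> S}"

definition cross_pairs :: "'a set \<Rightarrow> 'a set \<Rightarrow> 'a set set" where
  "cross_pairs V C = {{u, v} | u v. u \<in> C \<and> v \<in> V - C}"

definition internal :: "'a set set \<Rightarrow> 'a set \<Rightarrow> bool" where
  "internal L e \<longleftrightarrow> (\<exists>C\<in>L. e \<subseteq> C)"

(* A self-loop counts as 1/2 and every other pair as 1, so that s nodes contain
   s(s-1)/2 + s/2 = s^2/2 pairs; see pair_count_node_pairs. *)
definition pair_count :: "'a set set \<Rightarrow> real" where
  "pair_count A = (\<Sum>e\<in>A. real (card e) / 2)"

(* bernoulli_pmf clamps its parameter to [0, 1].  In the two-layer model this never takes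
   effect: edge_prob lies in [0, 1], and keep_prob for a community of layer k is 1 - p_k. *)
definition random_subset :: "'b set \<Rightarrow> ('b \<Rightarrow> real) \<Rightarrow> 'b set pmf" where
  "random_subset A pr = map_pmf Collect (Pi_pmf A False (\<lambda>e. bernoulli_pmf (pr e)))"

locale two_layer_sbm =
  fixes V :: "'a set" and n n1 n2 :: nat and p1 p2 :: real and L1 L2 :: "'a set set"
  assumes finite_V: "finite V" and card_V: "card V = n" and n_pos: "n > 0"
    and n1_ge: "n1 \<ge> 3" and n2_ge: "n2 \<ge> 3"
    and p1_bounds: "0 < p1" "p1 \<le> 1" and p2_bounds: "0 < p2" "p2 \<le> 1"
    and partition1: "partition_on V L1" and card_L1: "card L1 = n1"
    and partition2: "partition_on V L2" and card_L2: "card L2 = n2"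
    and size1: "\<And>C. C \<in> L1 \<Longrightarrow> real (card C) = real n / real n1"
    and size2: "\<And>C. C \<in> L2 \<Longrightarrow> real (card C) = real n / real n2"
    and size12: "\<And>C D. C \<in> L1 \<Longrightarrow> D \<in> L2 \<Longrightarrow>
                   real (card (C \<inter> D)) = real n / (real n1 * real n2)"

definition edge_prob :: "real \<Rightarrow> real \<Rightarrow> 'a set set \<Rightarrow> 'a set set \<Rightarrow> 'a set \<Rightarrow> real" where
  "edge_prob p1 p2 L1 L2 e =
     (if internal L1 e \<and> internal L2 e then p1 + p2 - p1 * p2
      else if internal L1 e then p1
      else if internal L2 e then p2
      else 0)"

definition sbm_network ::
  "'a set \<Rightarrow> real \<Rightarrow> real \<Rightarrow> 'a set set \<Rightarrow> 'a set set \<Rightarrow> 'a set set pmf" where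
  "sbm_network V p1 p2 L1 L2 = random_subset (node_pairs V) (edge_prob p1 p2 L1 L2)"

definition expected_edges :: "'a set set pmf \<Rightarrow> 'a set set \<Rightarrow> real" where
  "expected_edges G A = measure_pmf.expectation G (\<lambda>E. pair_count (E \<inter> A))"

definition edges_in :: "'a set set pmf \<Rightarrow> 'a set \<Rightarrow> real" where
  "edges_in G C = expected_edges G (node_pairs C)"

definition edges_out :: "'a set \<Rightarrow> 'a set set pmf \<Rightarrow> 'a set \<Rightarrow> real" where
  "edges_out V G C = expected_edges G (cross_pairs V C)"

definition degree_sum :: "'a set \<Rightarrow> 'a set set pmf \<Rightarrow> 'a set \<Rightarrow> real" where
  "degree_sum V G C = 2 * edges_in G C + edges_out V G C"

(* Equal to half the sum of degree_sum over the communities of any layer;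
   see total_edges_eq. *)
definition total_edges :: "'a set \<Rightarrow> 'a set set pmf \<Rightarrow> real" where
  "total_edges V G = expected_edges G (node_pairs V)"

definition modularity :: "'a set \<Rightarrow> 'a set set \<Rightarrow> 'a set set pmf \<Rightarrow> real" where
  "modularity V L G =
     (\<Sum>C\<in>L. edges_in G C / total_edges V G - (degree_sum V G C / (2 * total_edges V G))\<^sup>2)"

definition observed_prob :: "'a set set pmf \<Rightarrow> 'a set \<Rightarrow> real" where
  "observed_prob G C = edges_in G C / ((real (card C))\<^sup>2 / 2)"

definition background_prob :: "'a set \<Rightarrow> 'a set set pmf \<Rightarrow> 'a set \<Rightarrow> real" where
  "background_prob V G C =
     edges_out V G C / (real (card C) * (real (card V) - real (card C)))"

definition keep_prob :: "'a set \<Rightarrow> 'a set set pmf \<Rightarrow> 'a set \<Rightarrow> real" where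
  "keep_prob V G C = (1 - observed_prob G C) / (1 - background_prob V G C)"

(* All keep probabilities are computed from the network G before the operation. *)
definition reduce_edge :: "'a set \<Rightarrow> 'a set set \<Rightarrow> 'a set set pmf \<Rightarrow> 'a set set pmf" where
  "reduce_edge V K G =
     bind_pmf G (\<lambda>E. random_subset E
       (\<lambda>e. if internal K e then keep_prob V G (THE C. C \<in> K \<and> e \<subseteq> C) else 1))"

lemma node_pairs_eq_image: "node_pairs S = (\<lambda>(u, v). {u, v}) ` (S \<times> S)"
  by (auto simp: node_pairs_def)

lemma finite_node_pairs: "finite S \<Longrightarrow> finite (node_pairs S)"
  by (simp add: node_pairs_eq_image)

lemma doubleton_in_node_pairs: "{a, b} \<in> node_pairs S \<longleftrightarrow> a \<in> S \<and> b \<in> S"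
  unfolding node_pairs_def by (auto simp: doubleton_eq_iff)

(* A proper pair has two orderings, a self-loop one. *)
lemma pair_count_ordered:
  assumes "finite V" "A \<subseteq> node_pairs V"
  shows "pair_count A = real (card {x \<in> V \<times> V. {fst x, snd x} \<in> A}) / 2"
proof -
  let ?f = "\<lambda>x. {fst x, snd x}"
  define R where "R = {x \<in> V \<times> V. ?f x \<in> A}"
  have finA: "finite A"
    by (rule finite_subset[OF assms(2) finite_node_pairs[OF assms(1)]])
  have finR: "finite R"
    unfolding R_def using assms(1) by simp
  have *: "card {x \<in> R. ?f x = e} = card e" if e: "e \<in> A" for e
  proof -
    obtain u v where uv: "e = {u, v}" "u \<in> V" "v \<in> V"
      using e assms(2) unfolding node_pairs_def by blast
    have "{x \<in> R. ?f x = e} = {(u, v), (v, u)}"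
    proof (rule set_eqI)
      fix x :: "'a \<times> 'a"
      obtain a b where x: "x = (a, b)" by fastforce
      show "x \<in> {x \<in> R. ?f x = e} \<longleftrightarrow> x \<in> {(u, v), (v, u)}"
        using uv e unfolding R_def x by (simp add: doubleton_eq_iff) (metis insert_commute)
    qed
    then show ?thesis using uv by (cases "u = v") simp_all
  qed
  have "(\<Sum>e\<in>A. \<Sum>x\<in>{x \<in> R. ?f x = e}. (1::nat)) = (\<Sum>x\<in>R. 1)"
    by (rule sum.group[OF finR finA]) (unfold R_def, blast)
  then have "card R = (\<Sum>e\<in>A. card e)"
    using * by simp
  then show ?thesis
    by (simp add: pair_count_def sum_divide_distrib R_def)
qed

lemma pair_count_node_pairs:
  assumes "finite S"
  shows "pair_count (node_pairs S) = (real (card S))\<^sup>2 / 2"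
proof -
  have "{x \<in> S \<times> S. {fst x, snd x} \<in> node_pairs S} = S \<times> S"
    by (auto simp: doubleton_in_node_pairs)
  then show ?thesis
    using pair_count_ordered[OF assms order_refl]
    by (simp add: card_cartesian_product power2_eq_square)
qed

lemma pair_count_layer:
  assumes V: "finite V" "partition_on V L"
  shows "pair_count (E \<inter> node_pairs V) =
    (\<Sum>C\<in>L. 2 * pair_count (E \<inter> node_pairs C) + pair_count (E \<inter> cross_pairs V C)) / 2"
proof -
  let ?f = "\<lambda>x. {fst x, snd x}"
  define R where "R = {x \<in> V \<times> V. ?f x \<in> E}"
  have finR: "finite R" unfolding R_def using V by simp
  have CV: "C \<subseteq> V" if "C \<in> L" for C using V that by (auto dest: partition_onD1)
  have inj: "u \<in> D \<Longrightarrow> C \<in> L \<Longrightarrow> D \<in> L \<Longrightarrow> u \<in> C \<Longrightarrow> C = D" for u C D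
    using partition_onD2[OF V(2)] by (auto simp: disjoint_def)
  have pV: "2 * pair_count (E \<inter> node_pairs V) = real (card R)"
  proof -
    have "{x \<in> V \<times> V. ?f x \<in> E \<inter> node_pairs V} = R"
      unfolding R_def by (auto simp: doubleton_in_node_pairs)
    then show ?thesis
      using pair_count_ordered[OF V(1), of "E \<inter> node_pairs V"] by simp
  qed
  have count_C: "2 * pair_count (E \<inter> node_pairs C) + pair_count (E \<inter> cross_pairs V C)
      = real (card {x \<in> R. fst x \<in> C})" if C: "C \<in> L" for C
  proof -
    let ?I = "{x \<in> R. fst x \<in> C \<and> snd x \<in> C}"
    let ?O = "{x \<in> R. fst x \<in> C \<and> snd x \<notin> C}"
    let ?O' = "{x \<in> R. fst x \<notin> C \<and> snd x \<in> C}"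
    have "node_pairs C \<subseteq> node_pairs V" "cross_pairs V C \<subseteq> node_pairs V"
      using CV[OF C] unfolding node_pairs_def cross_pairs_def by blast+
    then have sub: "E \<inter> node_pairs C \<subseteq> node_pairs V" "E \<inter> cross_pairs V C \<subseteq> node_pairs V"
      by blast+
    have outC: "{a, b} \<in> cross_pairs V C \<longleftrightarrow> (a \<in> C \<and> b \<notin> C) \<or> (a \<notin> C \<and> b \<in> C)"
      if "a \<in> V" "b \<in> V" for a b
      using that CV[OF C] unfolding cross_pairs_def by (auto simp: doubleton_eq_iff)
    have sI: "{x \<in> V \<times> V. ?f x \<in> E \<inter> node_pairs C} = ?I"
      unfolding R_def by (auto simp: doubleton_in_node_pairs)
    have sO: "{x \<in> V \<times> V. ?f x \<in> E \<inter> cross_pairs V C} = ?O \<union> ?O'"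
      unfolding R_def by (auto simp: outC)
    have swap: "?O' = prod.swap ` ?O"
    proof (rule set_eqI)
      fix x show "x \<in> ?O' \<longleftrightarrow> x \<in> prod.swap ` ?O"
        unfolding R_def by (cases x) (auto simp: insert_commute image_iff)
    qed
    have "card (?O \<union> ?O') = card ?O + card ?O'"
      by (rule card_Un_disjoint) (use finR in auto)
    also have "card ?O' = card ?O"
      unfolding swap by (rule card_image) simp
    finally have cO: "card (?O \<union> ?O') = 2 * card ?O" by simp
    have split: "{x \<in> R. fst x \<in> C} = ?I \<union> ?O" by blast
    have cI: "card {x \<in> R. fst x \<in> C} = card ?I + card ?O"
      unfolding split by (rule card_Un_disjoint) (use finR in auto)
    show ?thesis
      using pair_count_ordered[OF V(1) sub(1)] pair_count_ordered[OF V(1) sub(2)]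
      unfolding sI sO cO cI by simp
  qed
  have R: "R = (\<Union>C\<in>L. {x \<in> R. fst x \<in> C})"
    using partition_onD1[OF V(2)] unfolding R_def by auto
  have "card (\<Union>C\<in>L. {x \<in> R. fst x \<in> C}) = (\<Sum>C\<in>L. card {x \<in> R. fst x \<in> C})"
    by (rule card_UN_disjoint)
      (use finite_elements[OF V] finR inj in \<open>auto simp: disjoint_iff\<close>)
  then have "real (card R) = (\<Sum>C\<in>L. real (card {x \<in> R. fst x \<in> C}))"
    using R by simp
  then show ?thesis using pV count_C by simp
qed

lemma integrable_pair_count:
  assumes "finite A"
  shows "integrable (measure_pmf G) (\<lambda>E. pair_count (E \<inter> A))"
proof (rule measure_pmf.integrable_const_bound[where B = "pair_count A"])
  show "AE E in measure_pmf G. norm (pair_count (E \<inter> A)) \<le> pair_count A"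
    using assms by (auto simp: pair_count_def sum_nonneg intro!: sum_mono2)
qed simp

lemma total_edges_eq:
  assumes V: "finite V" "partition_on V L"
  shows "total_edges V G = (\<Sum>C\<in>L. degree_sum V G C) / 2"
proof -
  have int: "integrable (measure_pmf G) (\<lambda>E. pair_count (E \<inter> node_pairs C))"
            "integrable (measure_pmf G) (\<lambda>E. pair_count (E \<inter> cross_pairs V C))"
    if "C \<in> L" for C
  proof -
    have "C \<subseteq> V" using V that by (auto dest: partition_onD1)
    then have "node_pairs C \<subseteq> node_pairs V" "cross_pairs V C \<subseteq> node_pairs V"
      unfolding node_pairs_def cross_pairs_def by blast+
    then show "integrable (measure_pmf G) (\<lambda>E. pair_count (E \<inter> node_pairs C))"
              "integrable (measure_pmf G) (\<lambda>E. pair_count (E \<inter> cross_pairs V C))"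
      using finite_node_pairs[OF V(1)] by (auto intro: integrable_pair_count finite_subset)
  qed
  show ?thesis
    unfolding total_edges_def degree_sum_def edges_in_def edges_out_def expected_edges_def
      pair_count_layer[OF V]
    using int by simp
qed

end

theory Submission
  imports Defs
begin

text \<open>All quantities depend only on the marginals \<open>P({u, v} \<in> E)\<close>, which take one value for each of
the four ways a pair can lie in the two layers.  All communities \<open>C\<close> of a layer with \<open>m\<close> communities
then have the same expected numbers \<open>i\<close> of internal and \<open>o\<close> of outgoing edges, so its modularity is
\<open>2 i / (2 i + o) - 1 / m\<close>, which increases as soon as \<open>o / i\<close> decreases.  For the layer with edge
probability \<open>q\<close> the keep probability is exactly \<open>1 - q\<close>.  All edges leaving a community of the
other layer are internal to the reduced layer, hence \<open>o\<close> is multiplied by \<open>1 - q\<close>, whereas the edges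
inside that community that are not internal to the reduced layer survive, so \<open>i\<close> is multiplied by
more than \<open>1 - q\<close>.\<close>

section \<open>Expected edge counts as sums of marginals\<close>

definition inclusion_prob :: "'b set pmf \<Rightarrow> 'b \<Rightarrow> real" where
  "inclusion_prob G e = measure_pmf.prob G {E. e \<in> E}"

lemma expected_edges_eq_sum:
  assumes "finite A"
  shows "expected_edges G A = (\<Sum>e\<in>A. inclusion_prob G e * real (card e) / 2)"
proof -
  have "pair_count (E \<inter> A) = (\<Sum>e\<in>A. indicator {E. e \<in> E} E * (real (card e) / 2))" for E
    using assms unfolding pair_count_def
    by (subst Int_commute, subst sum.inter_restrict) (auto intro!: sum.cong simp: indicator_def)
  moreover have "integrable (measure_pmf G) (\<lambda>E. indicator {E. e \<in> E} E * (real (card e) / 2))" for e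
    by (intro integrable_mult_left) (simp add: measure_pmf.emeasure_eq_measure)
  ultimately show ?thesis
    unfolding expected_edges_def inclusion_prob_def
    by (simp add: Bochner_Integration.integral_sum)
qed

text \<open>The weight \<open>card e / 2\<close> is half the number of orderings of
  \<open>e\<close>: two for a proper pair, one for a self-loop. Summing over ordered pairs allows
  the first endpoint to be fixed and each row to be evaluated separately.\<close>

lemma edges_in_eq_sum:
  assumes "finite C"
  shows "edges_in G C = (\<Sum>u\<in>C. \<Sum>v\<in>C. inclusion_prob G {u, v}) / 2"
proof -
  let ?f = "\<lambda>(u, v). {u, v}"
  have fibre: "card {x \<in> C \<times> C. ?f x = e} = card e" if e: "e \<in> node_pairs C" for e
  proof -
    obtain u v where uv: "e = {u, v}" "u \<in> C" "v \<in> C"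
      using e unfolding node_pairs_def by blast
    have "x \<in> C \<times> C \<and> ?f x = e \<longleftrightarrow> x = (u, v) \<or> x = (v, u)" for x
      using uv(2,3) unfolding uv(1) by (cases x) (simp add: doubleton_eq_iff, blast)
    then have "{x \<in> C \<times> C. ?f x = e} = {x. x = (u, v) \<or> x = (v, u)}"
      by (rule Collect_cong)
    also have "\<dots> = {(u, v), (v, u)}" by blast
    finally have "card {x \<in> C \<times> C. ?f x = e} = card {(u, v), (v, u)}" by (rule arg_cong)
    also have "\<dots> = card e" unfolding uv(1) by (cases "u = v") simp_all
    finally show ?thesis .
  qed
  have "(\<Sum>e\<in>node_pairs C. inclusion_prob G e * real (card e))
      = (\<Sum>e\<in>node_pairs C. \<Sum>x\<in>{x \<in> C \<times> C. ?f x = e}. inclusion_prob G (?f x))"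
    by (rule sum.cong) (simp_all add: fibre)
  also have "\<dots> = (\<Sum>x\<in>C \<times> C. inclusion_prob G (?f x))"
    using assms by (intro sum.group) (auto simp: finite_node_pairs node_pairs_eq_image)
  finally show ?thesis
    unfolding edges_in_def expected_edges_eq_sum[OF finite_node_pairs[OF assms]]
    by (simp add: sum.cartesian_product case_prod_unfold flip: sum_divide_distrib)
qed

text \<open>With the endpoint in \<open>C\<close> put first, a crossing pair has a single ordering,
  and it is never a self-loop. Its weight is 1, so no factor 1/2 remains.\<close>

lemma edges_out_eq_sum:
  assumes "finite V" "C \<subseteq> V"
  shows "edges_out V G C = (\<Sum>u\<in>C. \<Sum>v\<in>V - C. inclusion_prob G {u, v})"
proof -
  let ?f = "\<lambda>(u, v). {u, v}"
  have eq: "cross_pairs V C = ?f ` (C \<times> (V - C))"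
    by (auto simp: cross_pairs_def)
  have fin: "finite (C \<times> (V - C))"
    using assms by (auto intro: finite_subset)
  have inj: "inj_on ?f (C \<times> (V - C))"
    by (auto simp: inj_on_def doubleton_eq_iff)
  have "edges_out V G C = (\<Sum>x\<in>C \<times> (V - C). inclusion_prob G (?f x) * real (card (?f x)) / 2)"
    unfolding edges_out_def eq using fin by (simp add: expected_edges_eq_sum sum.reindex[OF inj])
  also have "\<dots> = (\<Sum>x\<in>C \<times> (V - C). inclusion_prob G (?f x))"
  proof (rule sum.cong[OF refl])
    fix x assume "x \<in> C \<times> (V - C)"
    then have "card (?f x) = 2" by (cases x) (auto simp: card_2_iff)
    then show "inclusion_prob G (?f x) * real (card (?f x)) / 2 = inclusion_prob G (?f x)" by simp
  qed
  finally show ?thesis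
    by (simp add: sum.cartesian_product case_prod_unfold)
qed

section \<open>Marginals of random subsets and of thinning\<close>

lemma inclusion_prob_random_subset:
  assumes "finite A" "e \<in> A" "0 \<le> pr e" "pr e \<le> 1"
  shows "inclusion_prob (random_subset A pr) e = pr e"
proof -
  have "inclusion_prob (random_subset A pr) e
      = measure_pmf.prob (map_pmf (\<lambda>f. f e) (Pi_pmf A False (\<lambda>e. bernoulli_pmf (pr e)))) {True}"
    unfolding inclusion_prob_def random_subset_def measure_map_pmf
    by (rule arg_cong[where f = "measure_pmf.prob _"]) auto
  also have "map_pmf (\<lambda>f. f e) (Pi_pmf A False (\<lambda>e. bernoulli_pmf (pr e))) = bernoulli_pmf (pr e)"
    using assms by (simp add: Pi_pmf_component)
  finally show ?thesis
    using assms by (simp add: measure_pmf_single)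
qed

lemma set_pmf_random_subset:
  assumes "finite A" "E \<in> set_pmf (random_subset A pr)"
  shows "E \<subseteq> A"
proof -
  obtain f where "E = Collect f" "f \<in> set_pmf (Pi_pmf A False (\<lambda>e. bernoulli_pmf (pr e)))"
    using assms(2) by (auto simp: random_subset_def)
  then show ?thesis
    using set_Pi_pmf_subset[OF assms(1), of False "\<lambda>e. bernoulli_pmf (pr e)"] by auto
qed

text \<open>Given the network \<open>E\<close>, the edge \<open>e\<close> survives with probability
  \<open>pr e\<close> if \<open>e \<in> E\<close> and never otherwise; averaging over
  \<open>G\<close> gives the product. Here \<open>pr\<close> is the same for every \<open>E\<close>,
  as in \<open>reduce_edge\<close>, whose keep probabilities come from \<open>G\<close>
  itself.\<close>

lemma inclusion_prob_thinning:
  assumes "\<And>E. E \<in> set_pmf G \<Longrightarrow> finite E" "0 \<le> pr e" "pr e \<le> 1"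
  shows "inclusion_prob (bind_pmf G (\<lambda>E. random_subset E pr)) e = inclusion_prob G e * pr e"
proof -
  have "inclusion_prob (random_subset E pr) e = indicator {E. e \<in> E} E * pr e"
    if "E \<in> set_pmf G" for E
  proof (cases "e \<in> E")
    case True
    then show ?thesis using assms that by (simp add: inclusion_prob_random_subset)
  next
    case False
    then have "inclusion_prob (random_subset E pr) e = 0"
      using assms(1)[OF that] set_pmf_random_subset[of E _ pr]
      unfolding inclusion_prob_def by (subst measure_pmf_zero_iff) auto
    then show ?thesis using False by simp
  qed
  then have "measure_pmf.expectation G (\<lambda>E. inclusion_prob (random_subset E pr) e)
      = measure_pmf.expectation G (\<lambda>E. indicator {E. e \<in> E} E * pr e)"
    by (intro integral_cong_AE) (auto simp: AE_measure_pmf_iff)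
  then show ?thesis
    unfolding inclusion_prob_def measure_pmf_bind
    by (subst measure_pmf.measure_bind[where N = "count_space UNIV"])
       (auto simp: measure_pmf_in_subprob_algebra)
qed

section \<open>Modularity of a layer whose communities all look alike\<close>

lemma modularity_uniform:
  assumes "finite V" "partition_on V L"
    and i: "\<And>C. C \<in> L \<Longrightarrow> edges_in G C = i" and o: "\<And>C. C \<in> L \<Longrightarrow> edges_out V G C = out"
    and "card L > 0" "2 * i + out > 0"
  shows "modularity V L G = 2 * i / (2 * i + out) - 1 / real (card L)"
proof -
  define m d where "m = real (card L)" and "d = 2 * i + out"
  have pos: "m > 0" "d > 0" using assms by (auto simp: m_def d_def)
  have deg: "degree_sum V G C = d" if "C \<in> L" for C
    using that i o by (simp add: degree_sum_def d_def)
  have total: "total_edges V G = m * d / 2"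
    unfolding total_edges_eq[OF assms(1,2)] by (simp add: deg m_def)
  have "modularity V L G = (\<Sum>C\<in>L. i / (m * d / 2) - (d / (2 * (m * d / 2)))\<^sup>2)"
    unfolding modularity_def total by (intro sum.cong) (simp_all add: deg i)
  also have "\<dots> = m * (i / (m * d / 2) - (d / (m * d))\<^sup>2)"
    by (simp add: m_def)
  \<comment> \<open>Each community has the share \<open>1 / m\<close> of the total degree, so the
    squares add up to \<open>m * (1 / m)^2 = 1 / m\<close> in every such network.\<close>
  also have "\<dots> = 2 * i / d - 1 / m"
    using pos by (simp add: field_simps power2_eq_square)
  finally show ?thesis by (simp add: m_def d_def)
qed

lemma internal_pair_iff:
  assumes "partition_on V L" "C \<in> L" "u \<in> C"
  shows "internal L {u, v} \<longleftrightarrow> v \<in> C"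
  using assms partition_onD2[OF assms(1)] by (auto simp: internal_def disjoint_def)

text \<open>The common shape of the marginals before and after ReduceEdge. The weight
  \<open>w12\<close> is a separate parameter because after the operation it is no longer
  \<open>w1 + w2 - w1 * w2\<close>.\<close>

definition layer_weight :: "real \<Rightarrow> real \<Rightarrow> real \<Rightarrow> 'a set set \<Rightarrow> 'a set set \<Rightarrow> 'a set \<Rightarrow> real" where
  "layer_weight w1 w2 w12 L1 L2 e =
     (if internal L1 e \<and> internal L2 e then w12
      else if internal L1 e then w1
      else if internal L2 e then w2
      else 0)"

lemma edge_prob_eq_layer_weight:
  "edge_prob p1 p2 L1 L2 = layer_weight p1 p2 (p1 + p2 - p1 * p2) L1 L2"
  by (auto simp: edge_prob_def layer_weight_def fun_eq_iff)

section \<open>Edge counts and modularity for marginals given by layer weights\<close>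

context two_layer_sbm
begin

text \<open>Transfers results about \<open>L1\<close> to \<open>L2\<close>: first the keep
  probability of the reduced layer, finally the second case of the theorem.\<close>

lemma swap: "two_layer_sbm V n n2 n1 p2 p1 L2 L1"
proof unfold_locales
  show "real (card (C \<inter> D)) = real n / (real n2 * real n1)" if "C \<in> L2" "D \<in> L1" for C D
    using size12[OF that(2,1)] by (simp add: Int_commute mult.commute)
qed (fact finite_V card_V n_pos n1_ge n2_ge p1_bounds p2_bounds partition1 partition2
    card_L1 card_L2 size1 size2)+

lemma sbm_network_swap: "sbm_network V p2 p1 L2 L1 = sbm_network V p1 p2 L1 L2"
proof -
  have "edge_prob p2 p1 L2 L1 = edge_prob p1 p2 L1 L2"
    by (auto simp: edge_prob_def fun_eq_iff)
  then show ?thesis by (simp add: sbm_network_def)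
qed

lemma community_subset: "C \<in> L1 \<Longrightarrow> C \<subseteq> V"
  using partition1 by (auto dest: partition_onD1)

text \<open>Seen from any \<open>u\<close> in \<open>C\<close>, the fraction \<open>1 / n2\<close>
  of \<open>C\<close> shares the block of \<open>u\<close> in \<open>L2\<close> and has weight
  \<open>w12\<close>; the rest of \<open>C\<close> has weight \<open>w1\<close>. Hence all rows have
  the same sum.\<close>

lemma edges_in_layer_weight:
  assumes w: "\<And>e. e \<in> node_pairs V \<Longrightarrow> inclusion_prob G e = layer_weight w1 w2 w12 L1 L2 e"
    and C: "C \<in> L1"
  shows "edges_in G C = (real n / real n1)\<^sup>2 / 2 * (w12 / real n2 + w1 * (1 - 1 / real n2))"
proof -
  have finC: "finite C" using community_subset[OF C] finite_V by (rule finite_subset)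
  define s where "s = real n / real n1"
  have row: "(\<Sum>v\<in>C. inclusion_prob G {u, v}) = s * (w12 / real n2 + w1 * (1 - 1 / real n2))"
    if u: "u \<in> C" for u
  proof -
    obtain D where D: "D \<in> L2" "u \<in> D"
      using u community_subset[OF C] partition_onD1[OF partition2] by blast
    have inD: "real (card (C \<inter> D)) = s / real n2" using size12[OF C D(1)] by (simp add: s_def)
    have "card C = card (C \<inter> D) + card (C - D)" using card_Int_Diff[OF finC] by simp
    then have outD: "real (card (C - D)) = s - s / real n2"
      using size1[OF C] inD by (simp add: s_def)
    have "(\<Sum>v\<in>C. inclusion_prob G {u, v}) = (\<Sum>v\<in>C. if v \<in> D then w12 else w1)"
    proof (rule sum.cong[OF refl])
      fix v assume v: "v \<in> C"
      then have "{u, v} \<in> node_pairs V"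
        using u community_subset[OF C] by (auto simp: doubleton_in_node_pairs)
      then show "inclusion_prob G {u, v} = (if v \<in> D then w12 else w1)"
        using v by (simp add: w layer_weight_def internal_pair_iff[OF partition1 C u]
            internal_pair_iff[OF partition2 D])
    qed
    also have "\<dots> = real (card (C \<inter> D)) * w12 + real (card (C - D)) * w1"
      using finC by (simp add: sum.If_cases Diff_eq)
    finally show ?thesis unfolding inD outD by (simp add: algebra_simps)
  qed
  show ?thesis
    unfolding edges_in_eq_sum[OF finC]
    using size1[OF C] by (simp add: row s_def power2_eq_square)
qed

text \<open>A pair leaving \<open>C\<close> has nonzero weight only inside the block
  \<open>D\<close> of \<open>u\<close> in \<open>L2\<close>, and a fraction \<open>1 / n2\<close> of
  the nodes outside \<open>C\<close> lies in \<open>D\<close>.\<close>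

lemma edges_out_layer_weight:
  assumes w: "\<And>e. e \<in> node_pairs V \<Longrightarrow> inclusion_prob G e = layer_weight w1 w2 w12 L1 L2 e"
    and C: "C \<in> L1"
  shows "edges_out V G C = (real n / real n1) * (real n - real n / real n1) * (w2 / real n2)"
proof -
  note CV = community_subset[OF C]
  define s where "s = real n / real n1"
  have row: "(\<Sum>v\<in>V - C. inclusion_prob G {u, v}) = (real n - s) * (w2 / real n2)"
    if u: "u \<in> C" for u
  proof -
    obtain D where D: "D \<in> L2" "u \<in> D"
      using u CV partition_onD1[OF partition2] by blast
    have DV: "D \<subseteq> V" using partition2 D(1) by (auto dest: partition_onD1)
    then have finD: "finite D" using finite_V by (rule finite_subset)
    have "card D = card (D \<inter> C) + card (D - C)" using card_Int_Diff[OF finD] by simp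
    then have DC: "real (card (D - C)) = real n / real n2 - s / real n2"
      using size2[OF D(1)] size12[OF C D(1)] by (simp add: s_def Int_commute)
    have "(\<Sum>v\<in>V - C. inclusion_prob G {u, v}) = (\<Sum>v\<in>V - C. if v \<in> D then w2 else 0)"
    proof (rule sum.cong[OF refl])
      fix v assume v: "v \<in> V - C"
      then have "{u, v} \<in> node_pairs V"
        using u CV by (auto simp: doubleton_in_node_pairs)
      then show "inclusion_prob G {u, v} = (if v \<in> D then w2 else 0)"
        using v by (simp add: w layer_weight_def internal_pair_iff[OF partition1 C u]
            internal_pair_iff[OF partition2 D])
    qed
    also have "\<dots> = real (card ((V - C) \<inter> D)) * w2"
      using finite_V by (simp add: sum.If_cases)
    also have "(V - C) \<inter> D = D - C" using DV by blast
    finally show ?thesis unfolding DC by (simp add: algebra_simps diff_divide_distrib)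
  qed
  show ?thesis
    unfolding edges_out_eq_sum[OF finite_V CV]
    using size1[OF C] by (simp add: row s_def)
qed

text \<open>With \<open>s = n / n1\<close>, the edge counts are \<open>s^2 / 2 * i\<close> and
  \<open>s^2 * out\<close>, so \<open>s^2\<close> cancels. Strictness of \<open>w1 > 0\<close> keeps
  \<open>i\<close> positive even if \<open>w2\<close> and \<open>w12\<close> vanish, as they do
  after the reduction when \<open>p2 = 1\<close>.\<close>

lemma modularity_layer_weight:
  assumes w: "\<And>e. e \<in> node_pairs V \<Longrightarrow> inclusion_prob G e = layer_weight w1 w2 w12 L1 L2 e"
    and nonneg: "w1 > 0" "w2 \<ge> 0" "w12 \<ge> 0"
  defines "i \<equiv> w12 / real n2 + w1 * (1 - 1 / real n2)"
    and "out \<equiv> (real n1 - 1) * (w2 / real n2)"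
  shows "modularity V L1 G = i / (i + out) - 1 / real n1"
proof -
  define s2 where "s2 = (real n / real n1)\<^sup>2"
  have s2: "s2 > 0" using n_pos n1_ge by (simp add: s2_def)
  have io: "i > 0" "out \<ge> 0"
    using nonneg n1_ge n2_ge unfolding i_def out_def
    by (auto intro!: add_nonneg_pos mult_nonneg_nonneg mult_pos_pos)
  \<comment> \<open>This is \<open>n - s = s * (n1 - 1)\<close> for
    \<open>s = n / n1\<close>.\<close>
  have "(real n / real n1) * (real n - real n / real n1) * (w2 / real n2) = s2 * out"
    using n1_ge by (simp add: s2_def out_def field_simps power2_eq_square)
  then have "modularity V L1 G = 2 * (s2 / 2 * i) / (2 * (s2 / 2 * i) + s2 * out) - 1 / real (card L1)"
    using s2 io n1_ge card_L1 edges_in_layer_weight[OF w] edges_out_layer_weight[OF w]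
    by (intro modularity_uniform[OF finite_V partition1])
       (auto simp: s2_def i_def intro!: add_pos_nonneg)
  also have "\<dots> = s2 * i / (s2 * (i + out)) - 1 / real n1"
    using card_L1 by (simp add: distrib_left)
  finally show ?thesis using s2 by simp
qed

section \<open>The model before and after ReduceEdge\<close>

lemma inclusion_prob_sbm_network:
  assumes "e \<in> node_pairs V"
  shows "inclusion_prob (sbm_network V p1 p2 L1 L2) e =
    layer_weight p1 p2 (p1 + p2 - p1 * p2) L1 L2 e"
proof -
  \<comment> \<open>Both forms are visibly nonnegative, so \<open>bernoulli_pmf\<close> does not
    clamp the probability.\<close>
  have "p1 + p2 - p1 * p2 = p1 + p2 * (1 - p1)" "1 - (p1 + p2 - p1 * p2) = (1 - p1) * (1 - p2)"
    by (simp_all add: algebra_simps)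
  then have "0 \<le> p1 + p2 - p1 * p2" "p1 + p2 - p1 * p2 \<le> 1"
    using p1_bounds p2_bounds
    by (metis add_nonneg_nonneg diff_ge_0_iff_ge less_imp_le mult_nonneg_nonneg)+
  then have "0 \<le> edge_prob p1 p2 L1 L2 e" "edge_prob p1 p2 L1 L2 e \<le> 1"
    using p1_bounds p2_bounds by (auto simp: edge_prob_def)
  then show ?thesis
    unfolding sbm_network_def edge_prob_eq_layer_weight[symmetric]
    using assms finite_node_pairs[OF finite_V] by (simp add: inclusion_prob_random_subset)
qed

text \<open>A pair inside \<open>C\<close> is a non-edge iff both layers omit it, so
  \<open>1 - observed_prob\<close> factors as \<open>(1 - p1) * (1 - p2 / n2)\<close>. The second
  factor is exactly \<open>1 - background_prob\<close> and cancels.\<close>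

lemma keep_prob_sbm_network:
  assumes C: "C \<in> L1"
  shows "keep_prob V (sbm_network V p1 p2 L1 L2) C = 1 - p1"
proof -
  let ?G = "sbm_network V p1 p2 L1 L2"
  define s where "s = real n / real n1"
  have n1: "real n1 \<ge> 3" and n2: "real n2 \<ge> 3" using n1_ge n2_ge by auto
  have s: "s > 0" using n_pos n1_ge by (simp add: s_def)
  have ns: "real n - s > 0" using n_pos n1 by (simp add: s_def field_simps)
  have inn: "edges_in ?G C = s\<^sup>2 / 2 *
      ((p1 + p2 - p1 * p2) / real n2 + p1 * (1 - 1 / real n2))"
    unfolding s_def by (rule edges_in_layer_weight[OF _ C]) (rule inclusion_prob_sbm_network)
  have out: "edges_out V ?G C = s * (real n - s) * (p2 / real n2)"
    unfolding s_def by (rule edges_out_layer_weight[OF _ C]) (rule inclusion_prob_sbm_network)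
  have "observed_prob ?G C = (p1 + p2 - p1 * p2) / real n2 + p1 * (1 - 1 / real n2)"
    unfolding observed_prob_def inn size1[OF C] s_def[symmetric] using s by simp
  moreover have "background_prob V ?G C = p2 / real n2"
    unfolding background_prob_def out size1[OF C] card_V s_def[symmetric] using s ns by simp
  moreover have "1 - ((p1 + p2 - p1 * p2) / real n2 + p1 * (1 - 1 / real n2))
      = (1 - p1) * (1 - p2 / real n2)"
    using n2 by (simp add: field_simps)
  moreover have "1 - p2 / real n2 \<noteq> 0" using n2 p2_bounds by (simp add: field_simps)
  ultimately show ?thesis by (simp add: keep_prob_def)
qed

lemma inclusion_prob_reduce_edge:
  assumes e: "e \<in> node_pairs V"
  shows "inclusion_prob (reduce_edge V L2 (sbm_network V p1 p2 L1 L2)) e =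
    layer_weight p1 ((1 - p2) * p2) ((1 - p2) * (p1 + p2 - p1 * p2)) L1 L2 e"
proof -
  let ?G = "sbm_network V p1 p2 L1 L2"
  let ?keep = "\<lambda>e. if internal L2 e then keep_prob V ?G (THE C. C \<in> L2 \<and> e \<subseteq> C) else 1"
  interpret swapped: two_layer_sbm V n n2 n1 p2 p1 L2 L1 by (rule swap)
  \<comment> \<open>An edge is nonempty and the blocks are disjoint, so the description denotes the
    one community containing \<open>e\<close>.\<close>
  have "(THE C. C \<in> L2 \<and> e \<subseteq> C) \<in> L2" if int: "internal L2 e"
  proof -
    obtain C where C: "C \<in> L2" "e \<subseteq> C" using int by (auto simp: internal_def)
    obtain u where "u \<in> e" using e by (auto simp: node_pairs_def)
    then have "D = C" if "D \<in> L2" "e \<subseteq> D" for D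
      using C that disjointD[OF partition_onD2[OF partition2], of D C] by fast
    then have "(THE C. C \<in> L2 \<and> e \<subseteq> C) = C"
      using C by (intro the_equality) blast+
    then show ?thesis using C by simp
  qed
  then have keep: "?keep e = (if internal L2 e then 1 - p2 else 1)"
    using swapped.keep_prob_sbm_network by (simp add: sbm_network_swap)
  have "finite E" if "E \<in> set_pmf ?G" for E
    using that set_pmf_random_subset finite_node_pairs[OF finite_V]
    unfolding sbm_network_def by (metis finite_subset)
  then have "inclusion_prob (reduce_edge V L2 ?G) e = inclusion_prob ?G e * ?keep e"
    unfolding reduce_edge_def
    by (intro inclusion_prob_thinning) (unfold keep, use p2_bounds in auto)
  then show ?thesis
    unfolding keep inclusion_prob_sbm_network[OF e] by (auto simp: layer_weight_def)
qed

lemma modularity_reduce_edge_greater: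
  "modularity V L1 (reduce_edge V L2 (sbm_network V p1 p2 L1 L2))
     > modularity V L1 (sbm_network V p1 p2 L1 L2)"
proof -
  define i where "i = (p1 + p2 - p1 * p2) / real n2 + p1 * (1 - 1 / real n2)"
  define i' where "i' = (1 - p2) * (p1 + p2 - p1 * p2) / real n2 + p1 * (1 - 1 / real n2)"
  define out where "out = (real n1 - 1) * (p2 / real n2)"
  have n: "real n1 \<ge> 3" "real n2 \<ge> 3" using n1_ge n2_ge by auto
  have "p1 + p2 - p1 * p2 = p1 + p2 * (1 - p1)" by (simp add: algebra_simps)
  then have p12: "p1 + p2 - p1 * p2 \<ge> 0"
    using p1_bounds p2_bounds by (metis add_nonneg_nonneg diff_ge_0_iff_ge less_imp_le mult_nonneg_nonneg)
  have rest: "p1 * (1 - 1 / real n2) > 0" using p1_bounds n by simp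
  have "i > 0" "i' > 0"
    unfolding i_def i'_def using p12 rest p2_bounds by (auto intro!: add_nonneg_pos)
  have "out > 0" using p2_bounds n by (simp add: out_def)
  \<comment> \<open>The surplus over uniform scaling by \<open>1 - p2\<close> comes from the pairs
    inside a community of \<open>L1\<close> that are not internal to \<open>L2\<close>: ReduceEdge
    leaves them untouched.\<close>
  have "i' - (1 - p2) * i = p2 * (p1 * (1 - 1 / real n2))"
    unfolding i_def i'_def using n by (simp add: field_simps)
  then have i': "(1 - p2) * i < i'"
    using rest p2_bounds(1) by (metis diff_gt_0_iff_gt mult_pos_pos)
  have before: "modularity V L1 (sbm_network V p1 p2 L1 L2) = i / (i + out) - 1 / real n1"
    using modularity_layer_weight[OF inclusion_prob_sbm_network] p1_bounds p2_bounds p12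
    by (simp add: i_def out_def)
  have after: "modularity V L1 (reduce_edge V L2 (sbm_network V p1 p2 L1 L2))
      = i' / (i' + (1 - p2) * out) - 1 / real n1"
    using modularity_layer_weight[OF inclusion_prob_reduce_edge] p1_bounds p2_bounds p12
    by (simp add: i'_def out_def mult_ac)
  \<comment> \<open>Products instead of the ratios of \<open>out\<close> to \<open>i\<close> also
    cover \<open>p2 = 1\<close>, where no outgoing edges remain. Adding \<open>i * i'\<close> to
    both sides then gives the cross-multiplied comparison.\<close>
  have "i * ((1 - p2) * out) < i' * out"
    using mult_strict_right_mono[OF i' \<open>out > 0\<close>] by (simp add: mult_ac)
  then have "i * (i' + (1 - p2) * out) < i' * (i + out)"
    by (simp add: distrib_left mult.commute)
  moreover have "i + out > 0" "i' + (1 - p2) * out > 0"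
    using \<open>i > 0\<close> \<open>i' > 0\<close> \<open>out > 0\<close> p2_bounds by (auto intro!: add_pos_nonneg)
  ultimately have "i / (i + out) < i' / (i' + (1 - p2) * out)"
    by (simp add: pos_divide_less_eq pos_less_divide_eq)
  then show ?thesis unfolding before after by simp
qed

end

theorem theorem3:
  fixes V :: "'a set" and n n1 n2 :: nat and p1 p2 :: real
    and L1 L2 L K :: "'a set set"
  assumes "two_layer_sbm V n n1 n2 p1 p2 L1 L2"
    and "(L, K) \<in> {(L1, L2), (L2, L1)}"
  shows "modularity V L (reduce_edge V K (sbm_network V p1 p2 L1 L2))
           > modularity V L (sbm_network V p1 p2 L1 L2)"
proof -
  interpret two_layer_sbm V n n1 n2 p1 p2 L1 L2 by (rule assms(1))
  \<comment> \<open>The case \<open>L = L2\<close> is the case \<open>L = L1\<close> of the swapped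
    model, which has the same network.\<close>
  interpret swapped: two_layer_sbm V n n2 n1 p2 p1 L2 L1 by (rule swap)
  from assms(2) show ?thesis
    using modularity_reduce_edge_greater swapped.modularity_reduce_edge_greater
    by (auto simp: sbm_network_swap)
qed

end
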